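(* Let $r_{k,m}$ be the number of plateau polycubes of width $k$ and lateral area $m$. Then: 1. $r_{k,2k}=1$ for $k\geq 1$. 2. $r_{k,2k+1}=8k-8$ for $k\geq 2$. 3. $r_{k,2k+2}=32k^2-70k+48$ for $k\geq 3$.
   Context: A cell is a unit cube of the lattice $\mathbb{Z}^3$ with orthonormal coordinate system $(0,\vec i,\vec j,\vec k)$. A polycube is a finite (nonempty) union of cells, connected through their faces, and considered up to translation. Its width is the difference between its greatest and smallest indices (coordinates of its points) in the direction $\vec i$, i.e. the number of layers of cells it occupies in direction $\vec i$. A stratum is a polycube of width $1$; a plateau is a rectangular stratum (a full $1\times b\times c$ block of cells, of extent $1$ in direction $\vec i$). A plateau polycube is a polycube whose strata (its intersections with the successive unit-width layers orthogonal to $\vec i$) are all plateaus. The lateral area of a polycube is the sum of the areas (numbers of unit squares) of its projections onto the planes $(\vec i,\vec j)$ and $(\vec i,\vec k)$. *)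

theory Defs
  imports Main "HOL-Library.Product_Plus"
begin

text \<open>
  The triple (x, y, z) stands for the unit cube [x, x+1] \<times> [y, y+1] \<times> [z, z+1], its components
  being taken along the directions i, j, k. A finite union of cells is represented by the set of
  its cells.
\<close>

type_synonym cell = "int \<times> int \<times> int"

definition i_coord :: "cell \<Rightarrow> int" where
  "i_coord = (\<lambda>(x, y, z). x)"

definition share_face :: "cell \<Rightarrow> cell \<Rightarrow> bool" where
  "share_face = (\<lambda>(x, y, z) (x', y', z'). \<bar>x - x'\<bar> + \<bar>y - y'\<bar> + \<bar>z - z'\<bar> = 1)"

definition face_connected :: "cell set \<Rightarrow> bool" where
  "face_connected P \<longleftrightarrow>
     (\<forall>p\<in>P. \<forall>q\<in>P. (p, q) \<in> {(a, b). a \<in> P \<and> b \<in> P \<and> share_face a b}\<^sup>*)"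

text \<open>
  This predicate describes a polycube placed in space; the identification of translates is made
  when polycubes are counted.
\<close>

definition polycube :: "cell set \<Rightarrow> bool" where
  "polycube P \<longleftrightarrow> finite P \<and> P \<noteq> {} \<and> face_connected P"

text \<open>
  The points of a cell with first index x have i-coordinates between x and x + 1, hence the
  summand 1.
\<close>

definition width :: "cell set \<Rightarrow> int" where
  "width P = Max (i_coord ` P) + 1 - Min (i_coord ` P)"

definition stratum :: "cell set \<Rightarrow> bool" where
  "stratum S \<longleftrightarrow> polycube S \<and> width S = 1"

definition plateau :: "cell set \<Rightarrow> bool" where
  "plateau S \<longleftrightarrow> stratum S \<and>
     (\<exists>x y z b c. S = {x} \<times> {y..<y + b} \<times> {z..<z + c})"

definition layer :: "cell set \<Rightarrow> int \<Rightarrow> cell set" where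
  "layer P x = {p \<in> P. i_coord p = x}"

definition plateau_polycube :: "cell set \<Rightarrow> bool" where
  "plateau_polycube P \<longleftrightarrow> polycube P \<and> (\<forall>x \<in> i_coord ` P. plateau (layer P x))"

definition lateral_area :: "cell set \<Rightarrow> nat" where
  "lateral_area P = card ((\<lambda>(x, y, z). (x, y)) ` P) + card ((\<lambda>(x, y, z). (x, z)) ` P)"

definition translation_rel :: "(cell set \<times> cell set) set" where
  "translation_rel = {(P, Q). \<exists>v. Q = (\<lambda>p. p + v) ` P}"

lemma equiv_translation_rel: "equiv UNIV translation_rel"
proof (rule equivI)
  show "translation_rel \<subseteq> UNIV \<times> UNIV" by simp
  show "refl translation_rel"
    unfolding refl_on_def translation_rel_def by (auto simp del: split_paired_Ex intro!: exI[of _ 0])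
  show "sym translation_rel"
  proof (rule symI)
    fix P Q assume "(P, Q) \<in> translation_rel"
    then obtain v where "Q = (\<lambda>p. p + v) ` P" unfolding translation_rel_def by blast
    then have "P = (\<lambda>p. p + (- v)) ` Q" by (simp add: image_image)
    then show "(Q, P) \<in> translation_rel" unfolding translation_rel_def by blast
  qed
  show "trans translation_rel"
  proof (rule transI)
    fix P Q R assume "(P, Q) \<in> translation_rel" "(Q, R) \<in> translation_rel"
    then obtain v w where "Q = (\<lambda>p. p + v) ` P" "R = (\<lambda>p. p + w) ` Q"
      unfolding translation_rel_def by blast
    then have "R = (\<lambda>p. p + (v + w)) ` P" by (simp add: image_image add.assoc)
    then show "(P, R) \<in> translation_rel" unfolding translation_rel_def by blast
  qed
qed

definition num_plateau_polycubes :: "nat \<Rightarrow> nat \<Rightarrow> nat" where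
  "num_plateau_polycubes k m =
     card ({P. plateau_polycube P \<and> width P = int k \<and> lateral_area P = m} // translation_rel)"

end

theory Submission
  imports Defs
begin

text \<open>
  A plateau polycube of width \<open>k\<close> is a pile of \<open>k\<close> rectangles, one per layer. Two consecutive
  layers share a face precisely when their rectangles share a unit square, that is, when their
  sides overlap in each of the two lateral directions. So the two directions decouple: up to translation, a plateau
  polycube is an arbitrary pair of sequences of \<open>k\<close> segments in which consecutive segments overlap and
  the first segment starts at 0 (\<open>plateau_polycube_is_stack\<close>, \<open>plateau_polycube_stack\<close>,
  \<open>stack_translate_unique\<close>). Each of its two lateral projections is a disjoint union of \<open>k\<close> segments,
  so the lateral area is the total length of all \<open>2k\<close> segments. Measure a segment by its excess, which
  is its length minus 1. If \<open>a\<^sub>i\<close> is the number of such sequences of total excess \<open>i\<close>, then the number of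
  plateau polycubes of lateral area \<open>2k + e\<close> is the convolution \<open>\<Sum>i\<le>e. a\<^sub>i * a\<^sub>e\<^sub>-\<^sub>i\<close>
  (\<open>num_plateau_polycubes_eq\<close>).

  To find the \<open>a\<^sub>i\<close>, build a sequence one segment at a time: below a segment of excess \<open>t\<close> there are
  \<open>t + s + 1\<close> positions for an overlapping segment of excess \<open>s\<close>. The resulting recursion
  (\<open>num_continuations\<close>) solves for total excess at most 2 to \<open>a\<^sub>0 = 1\<close>, \<open>a\<^sub>1 = 4k - 4\<close> for
  \<open>k \<ge> 2\<close>, and \<open>a\<^sub>2 = 8k\<^sup>2 - 19k + 16\<close> for \<open>k \<ge> 3\<close>. The three numbers sought are \<open>a\<^sub>0\<^sup>2\<close>, \<open>2 a\<^sub>0 a\<^sub>1\<close> and \<open>2 a\<^sub>0 a\<^sub>2 + a\<^sub>1\<^sup>2\<close>.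
\<close>

section \<open>Chains of overlapping segments\<close>

text \<open>
  A segment is coded by its lowest cell and its excess, a natural number. Every code thus denotes a
  nonempty segment, distinct codes denote distinct segments, and the least possible total excess
  is 0 whatever the number of segments.
\<close>

definition points :: "int \<times> nat \<Rightarrow> int set" where
  "points = (\<lambda>(a, t). {a..a + int t})"

definition meets :: "int \<times> nat \<Rightarrow> int \<times> nat \<Rightarrow> bool" where
  "meets p q \<longleftrightarrow> points p \<inter> points q \<noteq> {}"

text \<open>
  Starting the first segment at 0 selects one representative of each translation class.
\<close>

definition aligned_chains :: "nat \<Rightarrow> nat \<Rightarrow> (int \<times> nat) list set" where
  "aligned_chains k e = {ss. length ss = k \<and> fst (hd ss) = 0 \<and> successively meets ss \<and>
     sum_list (map snd ss) = e}"

lemma points_pair: "points (a, t) = {a..a + int t}"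
  by (simp add: points_def)

lemma finite_points [simp]: "finite (points p)"
  by (cases p) (simp add: points_pair)

lemma points_nonempty [simp]: "points p \<noteq> {}"
  by (cases p) (simp add: points_pair)

lemma card_points [simp]: "card (points p) = snd p + 1"
  by (cases p) (simp add: points_pair)

lemma points_eq_iff [simp]: "points p = points q \<longleftrightarrow> p = q"
  by (cases p; cases q) (auto simp: points_pair)

text \<open>
  This interval of \<open>t + s + 1\<close> possible starting points is the source of the weight in the recursion
  below.
\<close>

lemma meets_pair: "meets (a, t) (c, s) \<longleftrightarrow> c \<in> {a - int s..a + int t}"
proof -
  have "max a c \<in> points (a, t) \<inter> points (c, s)" if "c \<in> {a - int s..a + int t}"
    using that by (auto simp: points_pair)
  moreover have "c \<in> {a - int s..a + int t}" if "y \<in> points (a, t) \<inter> points (c, s)" for y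
    using that by (auto simp: points_pair)
  ultimately show ?thesis
    unfolding meets_def by blast
qed

text \<open>
  The segment \<open>p\<close> only constrains the first segment of the continuation; its own excess is not part
  of the total \<open>e\<close>. By translation symmetry the count depends on \<open>p\<close> only through its excess, which is
  why \<open>num_continuations\<close> takes no position.
\<close>

definition continuations :: "nat \<Rightarrow> nat \<Rightarrow> int \<times> nat \<Rightarrow> (int \<times> nat) list set" where
  "continuations k e p = {ss. length ss = k \<and> successively meets (p # ss) \<and>
     sum_list (map snd ss) = e}"

primrec num_continuations :: "nat \<Rightarrow> nat \<Rightarrow> nat \<Rightarrow> nat" where
  "num_continuations 0 e t = (if e = 0 then 1 else 0)"
| "num_continuations (Suc k) e t = (\<Sum>s\<le>e. (t + s + 1) * num_continuations k (e - s) s)"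

lemma continuations_0: "continuations 0 e p = (if e = 0 then {[]} else {})"
  by (auto simp: continuations_def)

lemma continuations_Suc:
  "continuations (Suc k) e (a, t) =
     (\<Union>s\<le>e. \<Union>c\<in>{a - int s..a + int t}. (#) (c, s) ` continuations k (e - s) (c, s))"
  (is "?L = ?R")
proof (intro equalityI subsetI)
  fix ss assume "ss \<in> ?L"
  then have ss: "length ss = Suc k" "successively meets ((a, t) # ss)" "sum_list (map snd ss) = e"
    by (auto simp: continuations_def)
  then obtain c s ss' where ss': "ss = (c, s) # ss'"
    by (cases ss) auto
  with ss have "s \<le> e" "c \<in> {a - int s..a + int t}" "ss' \<in> continuations k (e - s) (c, s)"
    by (auto simp: continuations_def meets_pair)
  with ss' show "ss \<in> ?R"
    by blast
next
  fix ss assume "ss \<in> ?R"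
  then obtain c s ss' where "ss = (c, s) # ss'" "s \<le> e" "c \<in> {a - int s..a + int t}"
    "ss' \<in> continuations k (e - s) (c, s)"
    by blast
  then show "ss \<in> ?L"
    by (auto simp: continuations_def meets_pair)
qed

lemma continuations_count:
  "finite (continuations k e (a, t)) \<and> card (continuations k e (a, t)) = num_continuations k e t"
proof (induction k arbitrary: e a t)
  case 0
  then show ?case by (simp add: continuations_0)
next
  case (Suc k)
  have card_head: "card (\<Union>c\<in>{a - int s..a + int t}. (#) (c, s) ` continuations k (e - s) (c, s)) =
      (t + s + 1) * num_continuations k (e - s) s" for s
  proof -
    have "card (\<Union>c\<in>{a - int s..a + int t}. (#) (c, s) ` continuations k (e - s) (c, s)) =
        (\<Sum>c\<in>{a - int s..a + int t}. card ((#) (c, s) ` continuations k (e - s) (c, s)))"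
      by (rule card_UN_disjoint) (use Suc.IH in auto)
    also have "\<dots> = (\<Sum>c\<in>{a - int s..a + int t}. num_continuations k (e - s) s)"
      by (intro sum.cong) (use Suc.IH in \<open>auto simp: card_image\<close>)
    also have "\<dots> = (t + s + 1) * num_continuations k (e - s) s"
    proof -
      have "card {a - int s..a + int t} = t + s + 1" by simp
      then show ?thesis by (simp only: sum_constant) simp
    qed
    finally show ?thesis .
  qed
  have "card (continuations (Suc k) e (a, t)) =
      (\<Sum>s\<le>e. card (\<Union>c\<in>{a - int s..a + int t}. (#) (c, s) ` continuations k (e - s) (c, s)))"
    unfolding continuations_Suc by (rule card_UN_disjoint) (use Suc.IH in auto)
  then have "card (continuations (Suc k) e (a, t)) = num_continuations (Suc k) e t"
    by (simp add: card_head)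
  moreover have "finite (continuations (Suc k) e (a, t))"
    unfolding continuations_Suc using Suc.IH by auto
  ultimately show ?case by blast
qed

lemma aligned_chains_Suc: "aligned_chains (Suc k) e = (\<Union>s\<le>e. (#) (0, s) ` continuations k (e - s) (0, s))"
  (is "?L = ?R")
proof (intro equalityI subsetI)
  fix ss assume ss: "ss \<in> ?L"
  then obtain s ss' where ss': "ss = (0, s) # ss'"
    by (cases ss) (auto simp: aligned_chains_def)
  with ss have "s \<le> e" "ss' \<in> continuations k (e - s) (0, s)"
    by (auto simp: aligned_chains_def continuations_def)
  with ss' show "ss \<in> ?R"
    by blast
next
  fix ss assume "ss \<in> ?R"
  then show "ss \<in> ?L"
    by (auto simp: aligned_chains_def continuations_def)
qed

lemma finite_aligned_chains: "finite (aligned_chains (Suc k) e)"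
  unfolding aligned_chains_Suc using continuations_count by auto

lemma card_aligned_chains_Suc: "card (aligned_chains (Suc k) e) = (\<Sum>s\<le>e. num_continuations k (e - s) s)"
proof -
  have "card (aligned_chains (Suc k) e) = (\<Sum>s\<le>e. card ((#) (0, s) ` continuations k (e - s) (0, s)))"
    unfolding aligned_chains_Suc by (rule card_UN_disjoint) (use continuations_count in auto)
  also have "\<dots> = (\<Sum>s\<le>e. num_continuations k (e - s) s)"
    by (intro sum.cong) (use continuations_count in \<open>auto simp: card_image\<close>)
  finally show ?thesis .
qed

lemma atMost_2: "{..2::nat} = {0, 1, 2}"
  by auto

lemma num_continuations_excess_0: "num_continuations k 0 t = (if k = 0 then 1 else t + 1)"
proof (induction k arbitrary: t)
  case (Suc k)
  then show ?case by (cases k) simp_all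
qed simp

text \<open>
  A single segment of excess 1 must be placed either first, next to the given segment, or later.
  The recursion for this closed form needs only the case \<open>t = 0\<close> and the constant value for excess 0.
\<close>

lemma num_continuations_excess_1:
  "num_continuations (Suc k) 1 t = (if k = 0 then t + 2 else (t + 1) * (4 * k - 2) + 2 * (t + 2))"
proof (induction k arbitrary: t)
  case 0
  show ?case by simp
next
  case (Suc k)
  have "num_continuations (Suc (Suc k)) 1 t =
      (t + 1) * num_continuations (Suc k) 1 0 + (t + 2) * num_continuations (Suc k) 0 1"
    by (subst num_continuations.simps(2)) (simp add: atMost_Suc del: num_continuations.simps)
  then show ?case
    unfolding Suc.IH num_continuations_excess_0 by (cases k) (simp_all add: algebra_simps)
qed

text \<open>
  The recursion at \<open>t = 0\<close> refers to total excess 2 only at \<open>t = 0\<close> again, so the induction closes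
  without a formula for general \<open>t\<close>.
\<close>

lemma num_continuations_excess_2:
  "int (num_continuations (Suc (Suc k)) 2 0) = 8 * (int k)\<^sup>2 + 21 * int k + 18"
proof (induction k)
  case 0
  show ?case by (simp add: atMost_2)
next
  case (Suc k)
  have "num_continuations (Suc (Suc (Suc k))) 2 0 = num_continuations (Suc (Suc k)) 2 0 +
      2 * num_continuations (Suc (Suc k)) 1 1 + 3 * num_continuations (Suc (Suc k)) 0 2"
    by (subst num_continuations.simps(2))
      (simp add: atMost_2 del: num_continuations.simps)
  then show ?case
    using Suc.IH unfolding num_continuations_excess_0 num_continuations_excess_1
    by (simp add: algebra_simps power2_eq_square del: num_continuations.simps)
qed

lemma card_aligned_chains_0: "k \<ge> 1 \<Longrightarrow> card (aligned_chains k 0) = 1"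
  by (cases k) (auto simp: card_aligned_chains_Suc num_continuations_excess_0)

lemma card_aligned_chains_1:
  assumes "k \<ge> 2"
  shows "int (card (aligned_chains k 1)) = 4 * int k - 4"
proof -
  define j where "j = k - 2"
  then have k: "k = Suc (Suc j)"
    using assms by simp
  then have "card (aligned_chains k 1) = num_continuations (Suc j) 1 0 + num_continuations (Suc j) 0 1"
    by (simp add: card_aligned_chains_Suc atMost_Suc del: num_continuations.simps)
  then show ?thesis
    unfolding num_continuations_excess_0 num_continuations_excess_1 k by (cases j) auto
qed

lemma card_aligned_chains_2:
  assumes "k \<ge> 3"
  shows "int (card (aligned_chains k 2)) = 8 * (int k)\<^sup>2 - 19 * int k + 16"
proof -
  define j where "j = k - 3"
  then have k: "k = Suc (Suc (Suc j))"
    using assms by simp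
  then have "card (aligned_chains k 2) = num_continuations (Suc (Suc j)) 2 0 +
      num_continuations (Suc (Suc j)) 1 1 + num_continuations (Suc (Suc j)) 0 2"
    by (simp add: card_aligned_chains_Suc atMost_2 del: num_continuations.simps)
  then show ?thesis
    unfolding num_continuations_excess_0 num_continuations_excess_1 k
    using num_continuations_excess_2[of j]
    by (simp add: algebra_simps power2_eq_square del: num_continuations.simps)
qed

section \<open>Connectedness through faces\<close>

lemma share_face_sym: "share_face p q \<Longrightarrow> share_face q p"
  unfolding share_face_def case_prod_unfold by (simp only: abs_minus_commute)

lemma face_connected_singleton: "face_connected {p}"
  by (simp add: face_connected_def)

text \<open>
  One shared face joins two connected pieces. Rows, slabs and whole stacks are all shown to be
  connected by adding one piece at a time.
\<close>

lemma face_connected_Un: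
  assumes P: "face_connected P" and Q: "face_connected Q"
    and pq: "p \<in> P" "q \<in> Q" "share_face p q"
  shows "face_connected (P \<union> Q)"
proof -
  define R where "R S = {(a, b). a \<in> S \<and> b \<in> S \<and> share_face a b}\<^sup>*" for S
  have mono: "R P \<subseteq> R (P \<union> Q)" "R Q \<subseteq> R (P \<union> Q)"
    unfolding R_def by (rule rtrancl_mono; blast)+
  have "(p, q) \<in> R (P \<union> Q)" "(q, p) \<in> R (P \<union> Q)"
    unfolding R_def using pq share_face_sym by blast+
  moreover have trans: "(u, w) \<in> R (P \<union> Q)" if "(u, v) \<in> R (P \<union> Q)" "(v, w) \<in> R (P \<union> Q)" for u v w
    using that unfolding R_def by (rule rtrancl_trans)
  moreover have "\<forall>u\<in>P. (u, p) \<in> R P \<and> (p, u) \<in> R P" "\<forall>u\<in>Q. (u, q) \<in> R Q \<and> (q, u) \<in> R Q"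
    using P Q pq unfolding face_connected_def R_def by auto
  ultimately have "\<forall>u\<in>P \<union> Q. (u, p) \<in> R (P \<union> Q) \<and> (p, u) \<in> R (P \<union> Q)"
    using mono by blast
  then show ?thesis
    using trans unfolding face_connected_def R_def by blast
qed

text \<open>
  A path from \<open>p\<close> to \<open>q\<close> has to leave \<open>A\<close> somewhere.
\<close>

lemma face_connected_cut:
  assumes P: "face_connected P" and pq: "p \<in> P" "p \<in> A" "q \<in> P" "q \<notin> A"
  shows "\<exists>a\<in>P \<inter> A. \<exists>b\<in>P - A. share_face a b"
proof (rule ccontr)
  assume no_edge: "\<not> ?thesis"
  have "(p, q) \<in> {(a, b). a \<in> P \<and> b \<in> P \<and> share_face a b}\<^sup>*"
    using P pq unfolding face_connected_def by blast
  then have "q \<in> A"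
  proof (induction rule: rtrancl_induct)
    case base
    show ?case by (rule pq)
  next
    case (step u v)
    then show ?case using no_edge by blast
  qed
  with pq show False by blast
qed

lemma face_connected_row: "face_connected ({x} \<times> {y} \<times> points (c, s))"
proof (induction s)
  case 0
  show ?case by (simp add: points_pair face_connected_singleton)
next
  case (Suc s)
  have "{x} \<times> {y} \<times> points (c, Suc s) = {x} \<times> {y} \<times> points (c, s) \<union> {(x, y, c + int s + 1)}"
    by (auto simp: points_pair)
  moreover have "face_connected ({x} \<times> {y} \<times> points (c, s) \<union> {(x, y, c + int s + 1)})"
    by (rule face_connected_Un[OF Suc face_connected_singleton, of "(x, y, c + int s)"])
      (auto simp: points_pair share_face_def)
  ultimately show ?case by simp
qed

lemma face_connected_slab: "face_connected ({x} \<times> points p \<times> points q)"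
proof -
  obtain a t c s where pq: "p = (a, t)" "q = (c, s)"
    by (cases p; cases q)
  have "face_connected ({x} \<times> points (a, t) \<times> points (c, s))"
  proof (induction t)
    case 0
    show ?case using face_connected_row[of x a c s] by (simp add: points_pair)
  next
    case (Suc t)
    have "{x} \<times> points (a, Suc t) \<times> points (c, s) =
        {x} \<times> points (a, t) \<times> points (c, s) \<union> {x} \<times> {a + int t + 1} \<times> points (c, s)"
      by (auto simp: points_pair)
    moreover have "face_connected
        ({x} \<times> points (a, t) \<times> points (c, s) \<union> {x} \<times> {a + int t + 1} \<times> points (c, s))"
      by (rule face_connected_Un[OF Suc face_connected_row, of "(x, a + int t, c)"
            "(x, a + int t + 1, c)"])
        (auto simp: points_pair share_face_def)
    ultimately show ?case by simp
  qed
  with pq show ?thesis by simp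
qed

lemma i_coord_slab: "i_coord ` ({x} \<times> points p \<times> points q) = {x}"
proof -
  have "i_coord = fst" by (auto simp: i_coord_def)
  then show ?thesis by simp
qed

text \<open>
  The sides \<open>b\<close> and \<open>c\<close> in the definition of a plateau are arbitrary integers; nonemptiness of a
  stratum forces them to be positive, so that they are lengths of segments. Conversely a product of
  segments is connected, hence a stratum.
\<close>

lemma plateau_iff: "plateau S \<longleftrightarrow> (\<exists>x p q. S = {x} \<times> points p \<times> points q)"
proof
  assume S: "plateau S"
  then obtain x y z b c where box: "S = {x} \<times> {y..<y + b} \<times> {z..<z + c}"
    unfolding plateau_def by blast
  moreover have "S \<noteq> {}"
    using S unfolding plateau_def stratum_def polycube_def by blast
  ultimately have "b > 0" "c > 0" by auto
  then have "S = {x} \<times> points (y, nat (b - 1)) \<times> points (z, nat (c - 1))"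
    unfolding box by (auto simp: points_pair)
  then show "\<exists>x p q. S = {x} \<times> points p \<times> points q" by blast
next
  assume "\<exists>x p q. S = {x} \<times> points p \<times> points q"
  then obtain x a t c s where S: "S = {x} \<times> points (a, t) \<times> points (c, s)"
    by (metis surj_pair)
  have "i_coord ` S = {x}"
    unfolding S by (rule i_coord_slab)
  moreover have "S = {x} \<times> {a..<a + (int t + 1)} \<times> {c..<c + (int s + 1)}"
    unfolding S by (auto simp: points_pair)
  moreover have "polycube S"
    unfolding S polycube_def using face_connected_slab by auto
  ultimately show "plateau S"
    unfolding plateau_def stratum_def width_def by (intro conjI) (simp, simp, blast)
qed

section \<open>Plateau polycubes as pairs of chains\<close>

definition stack :: "(int \<times> nat) list \<Rightarrow> (int \<times> nat) list \<Rightarrow> cell set" where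
  "stack ys zs = (\<Union>i<length ys. {int i} \<times> points (ys ! i) \<times> points (zs ! i))"

lemma i_coord_stack: "i_coord ` stack ys zs = int ` {..<length ys}"
  unfolding stack_def image_UN i_coord_slab by blast

lemma layer_stack:
  "i < length ys \<Longrightarrow> layer (stack ys zs) (int i) = {int i} \<times> points (ys ! i) \<times> points (zs ! i)"
  unfolding stack_def layer_def i_coord_def by auto

lemma width_stack:
  assumes "ys \<noteq> []"
  shows "width (stack ys zs) = int (length ys)"
proof -
  obtain n where "length ys = Suc n"
    using assms by (cases ys) auto
  then have "int ` {..<length ys} = {0..int n}"
    using image_int_atLeastAtMost[of 0 n] by (simp add: lessThan_Suc_atMost atLeast0AtMost)
  moreover have "Max {0..int n} = int n" "Min {0..int n} = 0"
    by (rule Max_eqI Min_eqI; simp)+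
  ultimately show ?thesis
    by (simp add: width_def i_coord_stack \<open>length ys = Suc n\<close>)
qed

lemma face_connected_stack:
  assumes len: "length zs = length ys" and ne: "ys \<noteq> []"
    and chain: "successively meets ys" "successively meets zs"
  shows "face_connected (stack ys zs)"
proof -
  define slab where "slab i = {int i} \<times> points (ys ! i) \<times> points (zs ! i)" for i
  have "face_connected (\<Union>i<Suc n. slab i)" if "Suc n \<le> length ys" for n
    using that
  proof (induction n)
    case 0
    have "face_connected (slab 0)"
      unfolding slab_def by (rule face_connected_slab)
    then show ?case by (simp add: lessThan_Suc)
  next
    case (Suc n)
    then have "meets (ys ! n) (ys ! Suc n)" "meets (zs ! n) (zs ! Suc n)"
      using chain len by (simp_all add: successively_conv_nth)
    then obtain y z where "y \<in> points (ys ! n) \<inter> points (ys ! Suc n)"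
      "z \<in> points (zs ! n) \<inter> points (zs ! Suc n)"
      unfolding meets_def by blast
    then have "(int n, y, z) \<in> (\<Union>i<Suc n. slab i)" "(int (Suc n), y, z) \<in> slab (Suc n)"
      "share_face (int n, y, z) (int (Suc n), y, z)"
      by (auto simp: slab_def share_face_def)
    moreover have "face_connected (\<Union>i<Suc n. slab i)"
      using Suc by simp
    moreover have "face_connected (slab (Suc n))"
      unfolding slab_def by (rule face_connected_slab)
    ultimately have "face_connected ((\<Union>i<Suc n. slab i) \<union> slab (Suc n))"
      by (intro face_connected_Un)
    moreover have "(\<Union>i<Suc (Suc n). slab i) = (\<Union>i<Suc n. slab i) \<union> slab (Suc n)"
      by (auto simp: less_Suc_eq)
    ultimately show ?case by simp
  qed
  \<comment> \<open>The induction is over \<open>Suc n\<close> because the empty union offers no cell to attach to.\<close>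
  from this[of "length ys - 1"] show ?thesis
    using ne by (simp add: stack_def slab_def)
qed

lemma plateau_polycube_stack:
  assumes len: "length zs = length ys" and ne: "ys \<noteq> []"
    and chain: "successively meets ys" "successively meets zs"
  shows "plateau_polycube (stack ys zs)"
proof -
  have "i_coord ` stack ys zs \<noteq> {}"
    unfolding i_coord_stack using ne by (simp add: lessThan_empty_iff)
  then have "stack ys zs \<noteq> {}" by blast
  moreover have "finite (stack ys zs)"
    by (simp add: stack_def)
  ultimately have "polycube (stack ys zs)"
    using face_connected_stack[OF assms] by (simp add: polycube_def)
  moreover have "plateau (layer (stack ys zs) x)" if "x \<in> i_coord ` stack ys zs" for x
    using that layer_stack unfolding i_coord_stack plateau_iff by blast
  ultimately show ?thesis
    unfolding plateau_polycube_def by blast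
qed

text \<open>
  For either chain of a stack, this union is the corresponding lateral projection of the stack.
\<close>

lemma card_profile:
  "card (\<Union>i<length ss. {int i} \<times> points (ss ! i)) = length ss + sum_list (map snd ss)"
proof -
  have "card (\<Union>i<length ss. {int i} \<times> points (ss ! i)) =
      (\<Sum>i<length ss. card ({int i} \<times> points (ss ! i)))"
    by (rule card_UN_disjoint) auto
  also have "\<dots> = (\<Sum>i<length ss. snd (ss ! i) + 1)"
    by (simp add: card_cartesian_product)
  also have "\<dots> = length ss + sum_list (map snd ss)"
    by (simp only: sum.distrib) (simp add: sum_list_sum_nth atLeast0LessThan)
  finally show ?thesis .
qed

lemma lateral_area_stack:
  assumes "length zs = length ys"
  shows "lateral_area (stack ys zs) =
    2 * length ys + sum_list (map snd ys) + sum_list (map snd zs)"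
proof -
  have proj: "(\<lambda>(x, y, z). (x, y)) = map_prod id fst" "(\<lambda>(x, y, z). (x, z)) = map_prod id snd"
    by auto
  have "(\<lambda>(x, y, z). (x, y)) ` stack ys zs = (\<Union>i<length ys. {int i} \<times> points (ys ! i))"
    unfolding stack_def image_UN proj by (simp add: map_prod_surj_on[OF refl refl])
  moreover have "(\<lambda>(x, y, z). (x, z)) ` stack ys zs = (\<Union>i<length zs. {int i} \<times> points (zs ! i))"
    unfolding stack_def image_UN assms proj by (simp add: map_prod_surj_on[OF refl refl])
  ultimately have "lateral_area (stack ys zs) =
      length ys + sum_list (map snd ys) + (length zs + sum_list (map snd zs))"
    by (simp only: lateral_area_def card_profile)
  then show ?thesis
    using assms by simp
qed

lemma lateral_area_translate: "lateral_area ((\<lambda>p. p + v) ` P) = lateral_area P"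
proof -
  obtain vx vy vz where v: "v = (vx, vy, vz)"
    by (cases v)
  have "(\<lambda>(x, y, z). (x, y)) ` (\<lambda>p. p + v) ` P = (\<lambda>p. p + (vx, vy)) ` (\<lambda>(x, y, z). (x, y)) ` P"
    "(\<lambda>(x, y, z). (x, z)) ` (\<lambda>p. p + v) ` P = (\<lambda>p. p + (vx, vz)) ` (\<lambda>(x, y, z). (x, z)) ` P"
    by (force simp: v image_image case_prod_unfold)+
  then show ?thesis
    by (simp add: lateral_area_def card_image)
qed

text \<open>
  A face crossed when passing from the cells up to layer \<open>x\<close> to those above it can only be one between
  layers \<open>x\<close> and \<open>x + 1\<close>, so its two cells have the same lateral coordinates. Besides the overlap of
  consecutive layers this gives that no intermediate layer is empty.
\<close>

lemma polycube_consecutive_layers_meet: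
  assumes P: "polycube P" and x: "Min (i_coord ` P) \<le> x" "x < Max (i_coord ` P)"
  shows "\<exists>y z. (x, y, z) \<in> P \<and> (x + 1, y, z) \<in> P"
proof -
  have fin: "finite (i_coord ` P)" "i_coord ` P \<noteq> {}"
    using P by (auto simp: polycube_def)
  obtain p where p: "p \<in> P" "i_coord p = Min (i_coord ` P)"
    using Min_in[OF fin] by (metis imageE)
  obtain q where q: "q \<in> P" "i_coord q = Max (i_coord ` P)"
    using Max_in[OF fin] by (metis imageE)
  have "\<exists>a\<in>P \<inter> {a. i_coord a \<le> x}. \<exists>b\<in>P - {a. i_coord a \<le> x}. share_face a b"
  proof (rule face_connected_cut)
    show "face_connected P" using P by (simp add: polycube_def)
    show "p \<in> P" "p \<in> {a. i_coord a \<le> x}" using p x by simp_all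
    show "q \<in> P" "q \<notin> {a. i_coord a \<le> x}" using q x by simp_all
  qed
  then obtain a b where "a \<in> P \<inter> {a. i_coord a \<le> x}" "b \<in> P - {a. i_coord a \<le> x}"
    "share_face a b"
    by blast
  then have ab: "a \<in> P" "i_coord a \<le> x" "b \<in> P" "x < i_coord b" "share_face a b"
    by simp_all
  obtain ax ay az bx "by" bz where "a = (ax, ay, az)" "b = (bx, by, bz)"
    by (cases a; cases b)
  with ab have "a = (x, ay, az)" "b = (x + 1, ay, az)"
    by (auto simp: i_coord_def share_face_def)
  with ab show ?thesis by blast
qed

text \<open>
  Reading off the sides of the rectangle in each layer gives the two chains; translating the corner of
  the first rectangle to the origin aligns them.
\<close>

lemma plateau_polycube_is_stack:
  assumes P: "plateau_polycube P" and w: "width P = int k"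
  obtains ys zs v where "length ys = k" "length zs = k" "ys \<noteq> []"
    "fst (hd ys) = 0" "fst (hd zs) = 0"
    "successively meets ys" "successively meets zs" "P = (\<lambda>p. p + v) ` stack ys zs"
proof -
  define m where "m = Min (i_coord ` P)"
  have poly: "polycube P"
    using P by (simp add: plateau_polycube_def)
  then have fin: "finite (i_coord ` P)" "i_coord ` P \<noteq> {}"
    by (auto simp: polycube_def)
  have M: "Max (i_coord ` P) = m + int k - 1"
    using w by (simp add: width_def m_def)
  have "m \<le> Max (i_coord ` P)"
    unfolding m_def using fin by (meson Max_ge Min_in)
  then have k: "k > 0" using M by simp
  have meet: "\<exists>y z. (m + int i, y, z) \<in> P \<and> (m + int (Suc i), y, z) \<in> P" if "Suc i < k" for i
    using polycube_consecutive_layers_meet[OF poly, of "m + int i"] that M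
    by (simp add: m_def add_ac)
  have "m + int i \<in> i_coord ` P" if "i < k" for i
  proof (cases i)
    case 0
    then show ?thesis using Min_in[OF fin] by (simp add: m_def)
  next
    case (Suc j)
    then obtain y z where "(m + int i, y, z) \<in> P"
      using meet[of j] \<open>i < k\<close> unfolding Suc by blast
    then show ?thesis by (force simp: i_coord_def)
  qed
  then have "plateau (layer P (m + int i))" if "i < k" for i
    using P that unfolding plateau_polycube_def by blast
  then have "\<exists>x p q. layer P (m + int i) = {x} \<times> points p \<times> points q" if "i < k" for i
    using that by (simp add: plateau_iff)
  then obtain X p q where box: "\<And>i. i < k \<Longrightarrow> layer P (m + int i) = {X i} \<times> points (p i) \<times> points (q i)"
    by metis
  have mem: "(m + int i, y, z) \<in> P \<longleftrightarrow> y \<in> points (p i) \<and> z \<in> points (q i)" if "i < k" for i y z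
  proof -
    \<comment> \<open>A plateau is a box in some layer \<open>X i\<close>; any of its cells shows which one.\<close>
    obtain y0 z0 where "y0 \<in> points (p i)" "z0 \<in> points (q i)"
      by (meson all_not_in_conv points_nonempty)
    then have "(X i, y0, z0) \<in> layer P (m + int i)"
      using box that by simp
    then have "X i = m + int i"
      by (simp add: layer_def i_coord_def)
    moreover have "(m + int i, y, z) \<in> P \<longleftrightarrow> (m + int i, y, z) \<in> layer P (m + int i)"
      by (simp add: layer_def i_coord_def)
    ultimately show ?thesis
      using box that by simp
  qed
  define shift where "shift a s = (fst s - a, snd s)" for a :: int and s :: "int \<times> nat"
  have points_shift: "y \<in> points (shift a s) \<longleftrightarrow> y + a \<in> points s" for y a s
    by (cases s) (auto simp: shift_def points_pair)
  define ys where "ys = map (\<lambda>i. shift (fst (p 0)) (p i)) [0..<k]"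
  define zs where "zs = map (\<lambda>i. shift (fst (q 0)) (q i)) [0..<k]"
  define v where "v = (m, fst (p 0), fst (q 0))"
  have "hd ys = shift (fst (p 0)) (p 0)" "hd zs = shift (fst (q 0)) (q 0)"
    using k by (simp_all add: ys_def zs_def hd_map)
  then have "fst (hd ys) = 0" "fst (hd zs) = 0"
    by (simp_all add: shift_def)
  moreover have meets_shift: "meets (shift a s) (shift a t) \<longleftrightarrow> meets s t" for a s t
    by (cases s; cases t) (auto simp: shift_def meets_pair)
  have "meets (p i) (p (Suc i))" "meets (q i) (q (Suc i))" if "Suc i < k" for i
    using meet[OF that] mem that unfolding meets_def by fastforce+
  then have "successively meets ys" "successively meets zs"
    by (auto simp: successively_conv_nth ys_def zs_def meets_shift)
  moreover have "P = (\<lambda>p. p + v) ` stack ys zs"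
  proof (intro equalityI subsetI)
    fix c assume "c \<in> P"
    obtain x y z where c: "c = (x, y, z)" by (cases c)
    have "x \<in> i_coord ` P"
      using \<open>c \<in> P\<close> c by (force simp: i_coord_def)
    then have "m \<le> x" "x \<le> m + int k - 1"
      using fin M by (auto simp: m_def[symmetric] dest: Max_ge Min_le)
    define i where "i = nat (x - m)"
    have i: "x = m + int i" "i < k"
      using \<open>m \<le> x\<close> \<open>x \<le> m + int k - 1\<close> by (simp_all add: i_def)
    then have "(int i, y - fst (p 0), z - fst (q 0)) \<in> stack ys zs"
      using \<open>c \<in> P\<close> mem c by (auto simp: stack_def ys_def zs_def points_shift)
    moreover have "c = (int i, y - fst (p 0), z - fst (q 0)) + v"
      by (simp add: c v_def i)
    ultimately show "c \<in> (\<lambda>p. p + v) ` stack ys zs" by blast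
  next
    fix c assume "c \<in> (\<lambda>p. p + v) ` stack ys zs"
    then show "c \<in> P"
      using mem by (auto simp: stack_def ys_def zs_def points_shift v_def add.commute)
  qed
  ultimately show thesis
    using that[of ys zs v] k by (simp add: ys_def zs_def)
qed

text \<open>
  Both stacks have the origin as the corner of their first rectangle and occupy only nonnegative
  layers. Hence each of \<open>v\<close> and \<open>-v\<close>, being the image of the origin under the translation or its
  inverse, lies in one of the stacks, which forces first the layer and then the lateral components
  of \<open>v\<close> to vanish.
\<close>

lemma stack_translate_unique:
  assumes len: "length ys = k" "length zs = k" "length ys' = k" "length zs' = k" and k: "k > 0"
    and start: "fst (hd ys) = 0" "fst (hd zs) = 0" "fst (hd ys') = 0" "fst (hd zs') = 0"
    and eq: "stack ys' zs' = (\<lambda>p. p + v) ` stack ys zs"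
  shows "ys' = ys \<and> zs' = zs"
proof -
  obtain vx vy vz where v: "v = (vx, vy, vz)" by (cases v)
  have mem: "(int i, y, z) \<in> stack ss ts \<longleftrightarrow> y \<in> points (ss ! i) \<and> z \<in> points (ts ! i)"
    if "i < length ss" for i y z ss ts
    using that by (auto simp: stack_def)
  have shift: "(x, y, z) \<in> stack ys' zs' \<longleftrightarrow> (x - vx, y - vy, z - vz) \<in> stack ys zs" for x y z
    unfolding eq v by (force simp: image_iff)
  have ran: "0 \<le> x \<and> x < int k" if "(x, y, z) \<in> stack ss ts" "length ss = k" for x y z ss ts
    using that by (auto simp: stack_def)
  have fst0: "fst (ys ! 0) = 0" "fst (zs ! 0) = 0" "fst (ys' ! 0) = 0" "fst (zs' ! 0) = 0"
    using start len k by (simp_all add: hd_conv_nth[symmetric] flip: length_greater_0_conv)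
  have mem0: "(0, y, z) \<in> stack ys zs \<longleftrightarrow> y \<in> points (ys ! 0) \<and> z \<in> points (zs ! 0)"
    "(0, y, z) \<in> stack ys' zs' \<longleftrightarrow> y \<in> points (ys' ! 0) \<and> z \<in> points (zs' ! 0)" for y z
    using mem[of 0 ys y z zs] mem[of 0 ys' y z zs'] k by (simp_all only: len of_nat_0)
  have "(0, 0, 0) \<in> stack ys' zs'" "(0, 0, 0) \<in> stack ys zs"
    using fst0 by (auto simp: mem0 points_def case_prod_unfold)
  then have base: "(- vx, - vy, - vz) \<in> stack ys zs" "(vx, vy, vz) \<in> stack ys' zs'"
    using shift[of 0 0 0] shift[of vx vy vz] by simp_all
  then have vx: "vx = 0"
    using ran[OF base(1)] ran[OF base(2)] len by simp
  have "- vy \<in> points (ys ! 0)" "- vz \<in> points (zs ! 0)" "vy \<in> points (ys' ! 0)" "vz \<in> points (zs' ! 0)"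
    using base by (simp_all add: mem0 vx)
  then have "vy = 0" "vz = 0"
    using fst0 by (auto simp: points_def case_prod_unfold)
  with vx have same: "stack ys' zs' = stack ys zs"
    using shift by auto
  have "ys' ! i = ys ! i \<and> zs' ! i = zs ! i" if "i < k" for i
  proof -
    have "points (ys' ! i) \<times> points (zs' ! i) = points (ys ! i) \<times> points (zs ! i)"
      using mem[of i ys' _ _ zs'] mem[of i ys _ _ zs] same len that by auto
    then show ?thesis
      by (simp add: times_eq_iff)
  qed
  then show ?thesis
    using len by (auto intro: nth_equalityI)
qed

text \<open>
  The pairs of aligned chains form a system of representatives of the translation classes, and the
  excess above the minimal lateral area \<open>2k\<close> is split between the two chains.
\<close>

lemma num_plateau_polycubes_eq:
  assumes k: "k \<ge> 1"
  shows "num_plateau_polycubes k (2 * k + e) = (\<Sum>i\<le>e. card (aligned_chains k i) * card (aligned_chains k (e - i)))"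
proof -
  define N where "N = (\<Union>i\<le>e. aligned_chains k i \<times> aligned_chains k (e - i))"
  define X where "X = {P. plateau_polycube P \<and> width P = int k \<and> lateral_area P = 2 * k + e}"
  define cls where "cls = (\<lambda>(ys, zs). translation_rel `` {stack ys zs})"
  have N_iff: "(ys, zs) \<in> N \<longleftrightarrow> length ys = k \<and> length zs = k \<and> fst (hd ys) = 0 \<and> fst (hd zs) = 0 \<and>
      successively meets ys \<and> successively meets zs \<and>
      sum_list (map snd ys) + sum_list (map snd zs) = e" for ys zs
    unfolding N_def aligned_chains_def by auto
  have "inj_on cls N"
  proof (rule inj_onI)
    fix n n' assume n: "n \<in> N" "n' \<in> N" "cls n = cls n'"
    obtain ys zs ys' zs' where nn: "n = (ys, zs)" "n' = (ys', zs')"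
      by (cases n; cases n')
    have "(stack ys zs, stack ys' zs') \<in> translation_rel"
      using n(3) unfolding nn cls_def
      by (simp add: eq_equiv_class_iff[OF equiv_translation_rel])
    then obtain v where "stack ys' zs' = (\<lambda>p. p + v) ` stack ys zs"
      unfolding translation_rel_def by blast
    then have "ys' = ys \<and> zs' = zs"
      using n k unfolding nn N_iff by (intro stack_translate_unique[of ys k]) auto
    then show "n = n'" by (simp add: nn)
  qed
  moreover have "cls ` N = X // translation_rel"
  proof (intro equalityI subsetI)
    fix C assume "C \<in> cls ` N"
    then obtain ys zs where n: "(ys, zs) \<in> N" "C = translation_rel `` {stack ys zs}"
      unfolding cls_def by auto
    then have "ys \<noteq> []" using k by (auto simp: N_iff)
    then have "stack ys zs \<in> X"
      using n unfolding X_def N_iff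
      by (simp add: plateau_polycube_stack width_stack lateral_area_stack)
    then show "C \<in> X // translation_rel"
      unfolding n(2) by (rule quotientI)
  next
    fix C assume "C \<in> X // translation_rel"
    then obtain P where P: "P \<in> X" "C = translation_rel `` {P}"
      by (rule quotientE)
    then obtain ys zs v where st: "length ys = k" "length zs = k" "ys \<noteq> []"
      "fst (hd ys) = 0" "fst (hd zs) = 0" "successively meets ys" "successively meets zs"
      "P = (\<lambda>p. p + v) ` stack ys zs"
      unfolding X_def using plateau_polycube_is_stack by blast
    then have "lateral_area (stack ys zs) = 2 * k + e"
      using P unfolding X_def by (simp add: lateral_area_translate)
    then have "(ys, zs) \<in> N"
      using st by (simp add: N_iff lateral_area_stack)
    moreover have "(stack ys zs, P) \<in> translation_rel"
      unfolding translation_rel_def using st(8) by blast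
    then have "C = cls (ys, zs)"
      unfolding P(2) cls_def using equiv_class_eq[OF equiv_translation_rel] by auto
    ultimately show "C \<in> cls ` N" by blast
  qed
  ultimately have "num_plateau_polycubes k (2 * k + e) = card N"
    unfolding num_plateau_polycubes_def X_def[symmetric] by (metis card_image)
  also have "\<dots> = (\<Sum>i\<le>e. card (aligned_chains k i \<times> aligned_chains k (e - i)))"
  proof -
    have "finite (aligned_chains k i)" for i
      using k finite_aligned_chains by (cases k) auto
    moreover have "aligned_chains k i \<inter> aligned_chains k j = {}" if "i \<noteq> j" for i j
      using that by (auto simp: aligned_chains_def)
    ultimately show ?thesis
      unfolding N_def by (intro card_UN_disjoint) (auto simp: Times_Int_Times)
  qed
  finally show ?thesis
    by (simp add: card_cartesian_product)
qed

theorem theorem5p3: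
  shows "(\<forall>k\<ge>1. num_plateau_polycubes k (2 * k) = 1) \<and>
    (\<forall>k\<ge>2. int (num_plateau_polycubes k (2 * k + 1)) = 8 * int k - 8) \<and>
    (\<forall>k\<ge>3. int (num_plateau_polycubes k (2 * k + 2)) = 32 * (int k)\<^sup>2 - 70 * int k + 48)"
proof (intro conjI allI impI)
  fix k :: nat assume "k \<ge> 1"
  then show "num_plateau_polycubes k (2 * k) = 1"
    using num_plateau_polycubes_eq[of k 0] by (simp add: card_aligned_chains_0)
next
  fix k :: nat assume "k \<ge> 2"
  then show "int (num_plateau_polycubes k (2 * k + 1)) = 8 * int k - 8"
    using num_plateau_polycubes_eq[of k 1] card_aligned_chains_0[of k] card_aligned_chains_1[of k] by simp
next
  fix k :: nat assume k: "k \<ge> 3"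
  have "num_plateau_polycubes k (2 * k + 2) =
      2 * (card (aligned_chains k 0) * card (aligned_chains k 2)) + (card (aligned_chains k 1))\<^sup>2"
    using num_plateau_polycubes_eq[of k 2] k
    by (simp add: atMost_2 power2_eq_square)
  then have "int (num_plateau_polycubes k (2 * k + 2)) =
      2 * int (card (aligned_chains k 2)) + (int (card (aligned_chains k 1)))\<^sup>2"
    using k by (simp add: card_aligned_chains_0)
  also have "\<dots> = 2 * (8 * (int k)\<^sup>2 - 19 * int k + 16) + (4 * int k - 4)\<^sup>2"
    using k by (simp only: card_aligned_chains_1 card_aligned_chains_2)
  also have "\<dots> = 32 * (int k)\<^sup>2 - 70 * int k + 48"
    by (simp add: algebra_simps power2_eq_square)
  finally show "int (num_plateau_polycubes k (2 * k + 2)) = 32 * (int k)\<^sup>2 - 70 * int k + 48" .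
qed

end
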